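(* Let $p$ be an ultrafilter on $\omega$. Then $\mathscr G^p$ is closed under ultrafilter limits: if $u\in\mathscr G^p$ and $u_n\in\mathscr G^p$ for all $n<\omega$, then $u\text{-}\lim_n u_n\in\mathscr G^p$.
   Context: For ultrafilters $u,u_n$ on $\omega$, $u\text{-}\lim_n u_n=\{A\subseteq\omega : \{n : A\in u_n\}\in u\}$. For $p\in\beta\omega$ define $\mathscr G^p_1$ = the set of principal ultrafilters on $\omega$, $\mathscr G^p_{\alpha+1}=\{p\text{-}\lim_n u_n : u_n\in\mathscr G^p_\alpha\text{ for all } n\}$, $\mathscr G^p_\alpha=\bigcup_{\xi<\alpha}\mathscr G^p_\xi$ for limit $\alpha$, and $\mathscr G^p=\bigcup_{\alpha\ge1}\mathscr G^p_\alpha$. *)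

theory Defs
  imports Complex_Main
begin

text \<open>A set \<open>A\<close> belongs to the filter \<open>F\<close> iff \<^term>\<open>eventually (\<lambda>x. x \<in> A) F\<close>.\<close>

definition ultrafilter :: "'a filter \<Rightarrow> bool" where
  "ultrafilter F \<longleftrightarrow> F \<noteq> bot \<and> (\<forall>P. eventually P F \<or> eventually (\<lambda>x. \<not> P x) F)"

text \<open>
  The limit \<open>u\<close>-\<open>lim\<^sub>n v n\<close>, as a filter; see \<open>mem_ulim\<close> below.
\<close>

definition ulim :: "nat filter \<Rightarrow> (nat \<Rightarrow> nat filter) \<Rightarrow> nat filter" where
  "ulim u v = Abs_filter (\<lambda>P. eventually (\<lambda>n. eventually P (v n)) u)"

lemma eventually_ulim: "eventually P (ulim u v) \<longleftrightarrow> eventually (\<lambda>n. eventually P (v n)) u"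
  unfolding ulim_def
proof (rule eventually_Abs_filter, rule is_filter.intro)
  fix P Q
  assume "\<forall>\<^sub>F n in u. eventually P (v n)" "\<forall>\<^sub>F n in u. eventually Q (v n)"
  then show "\<forall>\<^sub>F n in u. \<forall>\<^sub>F x in v n. P x \<and> Q x"
    by eventually_elim (rule eventually_conj)
next
  fix P Q :: "nat \<Rightarrow> bool"
  assume *: "\<forall>x. P x \<longrightarrow> Q x" "\<forall>\<^sub>F n in u. eventually P (v n)"
  from *(2) show "\<forall>\<^sub>F n in u. eventually Q (v n)"
    by eventually_elim (use *(1) in \<open>auto elim: eventually_mono\<close>)
qed simp

lemma mem_ulim:
  "{A. \<forall>\<^sub>F x in ulim u v. x \<in> A} =
   {A. \<forall>\<^sub>F n in u. n \<in> {n. \<forall>\<^sub>F x in v n. x \<in> A}}"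
  by (simp add: eventually_ulim)

text \<open>
  Ordinals are represented by elements of well-orders. As the hierarchy starts at index 1, an
  element \<open>a\<close> of the well-order \<open>r\<close> stands for the ordinal \<open>1 + \<theta>\<close>, where \<open>\<theta>\<close> is the order type
  of \<^term>\<open>underS r a\<close>; so the least element stands for 1, successors stand for successors, and
  limits for limits. The recursion equations are \<open>G_stage_least\<close>, \<open>G_stage_succ\<close> and
  \<open>G_stage_limit\<close> below.
\<close>

definition succ_of :: "'i rel \<Rightarrow> 'i \<Rightarrow> 'i \<Rightarrow> bool" where
  "succ_of r b a \<longleftrightarrow> b \<in> underS r a \<and> underS r a \<subseteq> under r b"

definition G_stage :: "nat filter \<Rightarrow> 'i rel \<Rightarrow> 'i \<Rightarrow> nat filter set" where
  "G_stage p r = wo_rel.worec r (\<lambda>G a.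
     if underS r a = {} then range (\<lambda>n. principal {n})
     else if \<exists>b. succ_of r b a then {ulim p v | v b. succ_of r b a \<and> (\<forall>n. v n \<in> G b)}
     else (\<Union>b\<in>underS r a. G b))"

lemma G_stage_rec:
  assumes "Well_order r"
  shows "G_stage p r a =
    (if underS r a = {} then range (\<lambda>n. principal {n})
     else if \<exists>b. succ_of r b a then {ulim p v | v b. succ_of r b a \<and> (\<forall>n. v n \<in> G_stage p r b)}
     else (\<Union>b\<in>underS r a. G_stage p r b))"
proof -
  interpret wo_rel r using assms by (rule wo_rel.intro)
  let ?H = "\<lambda>G a. if underS a = {} then range (\<lambda>n. principal {n})
     else if \<exists>b. succ_of r b a then {ulim p v | v b. succ_of r b a \<and> (\<forall>n. v n \<in> G b)}
     else (\<Union>b\<in>underS a. G b)"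
  have "adm_wo ?H"
    unfolding adm_wo_def
  proof (intro allI impI)
    fix f g :: "'a \<Rightarrow> nat filter set" and a
    assume "\<forall>b\<in>underS a. f b = g b"
    then have eq: "f b = g b" if "b \<in> underS a" for b using that by blast
    then have eq': "f b = g b" if "succ_of r b a" for b using that by (simp add: succ_of_def)
    have "{ulim p v | v b. succ_of r b a \<and> (\<forall>n. v n \<in> f b)} =
          {ulim p v | v b. succ_of r b a \<and> (\<forall>n. v n \<in> g b)}"
      using eq' by blast
    then show "?H f a = ?H g a" using eq by simp
  qed
  from fun_cong[OF worec_fixpoint[OF this], of a] show ?thesis
    unfolding G_stage_def .
qed

lemma G_stage_least:
  assumes "Well_order r" "underS r a = {}"
  shows "G_stage p r a = range (\<lambda>n. principal {n})"
  using assms by (simp add: G_stage_rec)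

lemma succ_of_unique:
  assumes "Well_order r" "succ_of r b a" "succ_of r c a"
  shows "b = c"
proof -
  interpret wo_rel r using assms(1) by (rule wo_rel.intro)
  have "(b, c) \<in> r" "(c, b) \<in> r"
    using assms(2,3) unfolding succ_of_def underS_def under_def by blast+
  then show ?thesis using ANTISYM by (auto dest: antisymD)
qed

lemma G_stage_succ:
  assumes "Well_order r" "succ_of r b a"
  shows "G_stage p r a = {ulim p v | v. \<forall>n. v n \<in> G_stage p r b}"
proof -
  have "underS r a \<noteq> {}" using assms(2) by (auto simp: succ_of_def)
  moreover have "succ_of r c a \<longleftrightarrow> c = b" for c
    using succ_of_unique[OF assms] assms(2) by blast
  ultimately show ?thesis by (subst G_stage_rec[OF assms(1)]) simp
qed

lemma G_stage_limit:
  assumes "Well_order r" "underS r a \<noteq> {}" "\<nexists>b. succ_of r b a"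
  shows "G_stage p r a = (\<Union>b\<in>underS r a. G_stage p r b)"
  using assms by (subst G_stage_rec) auto

text \<open>
  HOL cannot quantify over well-orders on all types at once. The well-orders on \<^typ>\<open>nat filter\<close>
  have all order types of cardinality at most that of the set of all filters on \<^typ>\<open>nat\<close>, and
  an increasing hierarchy of sets of filters is constant from some such index on. That
  nothing is lost by the restriction is the lemma \<open>G_stage_subset_G\<close> below, for well-orders on
  an arbitrary type.
\<close>

definition G :: "nat filter \<Rightarrow> nat filter set" where
  "G p = (\<Union>r \<in> {r :: nat filter rel. Well_order r}. \<Union>a \<in> Field r. G_stage p r a)"

lemma ulim_const:
  assumes "p \<noteq> bot"
  shows "ulim p (\<lambda>_. u) = u"
  using assms by (simp add: filter_eq_iff eventually_ulim eventually_const)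

lemma G_stage_mono:
  assumes r: "Well_order r" and p: "p \<noteq> bot" and ba: "(b, a) \<in> r"
  shows "G_stage p r b \<subseteq> G_stage p r a"
proof -
  interpret wo_rel r using r by (rule wo_rel.intro)
  have "\<forall>b. (b, a) \<in> r \<longrightarrow> G_stage p r b \<subseteq> G_stage p r a"
  proof (induction a rule: well_order_induct)
    case (1 a)
    show ?case
    proof (intro allI impI)
      fix b assume "(b, a) \<in> r"
      show "G_stage p r b \<subseteq> G_stage p r a"
      proof (cases "b = a")
        case False
        with \<open>(b, a) \<in> r\<close> have b: "b \<in> underS a" by (simp add: underS_def)
        show ?thesis
        proof (cases "\<exists>c. succ_of r c a")
          case True
          then obtain c where c: "succ_of r c a" by blast
          then have "(b, c) \<in> r" "(c, a) \<in> r" "c \<noteq> a"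
            using b by (auto simp: succ_of_def underS_def under_def)
          with 1 have "G_stage p r b \<subseteq> G_stage p r c" by blast
          also have "\<dots> \<subseteq> G_stage p r a"
          proof
            fix u assume "u \<in> G_stage p r c"
            then have "\<exists>v. u = ulim p v \<and> (\<forall>n. v n \<in> G_stage p r c)"
              using ulim_const[OF p, of u] by (intro exI[of _ "\<lambda>_. u"]) simp
            then show "u \<in> G_stage p r a" by (simp add: G_stage_succ[OF r c])
          qed
          finally show ?thesis .
        next
          case False
          then show ?thesis using b G_stage_limit[OF r _ False] by blast
        qed
      qed simp
    qed
  qed
  with ba show ?thesis by blast
qed

context
  includes cardinal_syntax
begin

lemma ex_regular_order:
  "\<exists>R :: nat filter rel. Card_order R \<and> infinite (Field R) \<and> regularCard R \<and> natLeq <o R"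
proof -
  let ?K = "cardSuc natLeq"
  have inf: "Cinfinite natLeq" by (rule natLeq_Cinfinite)
  have K: "Cinfinite ?K" "regularCard ?K"
    using inf by (simp_all add: Cinfinite_cardSuc regularCard_cardSuc)
  have "inj (principal :: nat set \<Rightarrow> nat filter)"
    by (auto intro!: injI simp: principal_inject)
  then have "inj_on (principal :: nat set \<Rightarrow> nat filter) (Field ?K)"
    by (rule inj_on_subset) simp
  then have "|Field ?K| =o |principal ` Field ?K|"
    using card_of_ordIsoI inj_on_imp_bij_betw by blast
  then have iso: "?K =o |principal ` Field ?K|"
    using card_of_Field_ordIso K(1) ordIso_symmetric ordIso_transitive by blast
  have "Cinfinite |principal ` Field ?K|"
    using Cinfinite_cong[OF iso] K(1) by blast
  moreover have "regularCard |principal ` Field ?K|"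
    using regularCard_ordIso[OF iso] K by blast
  moreover have "natLeq <o |principal ` Field ?K|"
    using iso cardSuc_greater natLeq_Card_order ordLess_ordIso_trans by blast
  ultimately show ?thesis by (auto simp: cinfinite_def)
qed

lemma ex_succ_of:
  assumes R: "Card_order R" "infinite (Field R)" and a: "a \<in> Field R"
  shows "\<exists>c\<in>Field R. succ_of R a c"
proof -
  interpret wo_rel R using R(1) by (auto intro: wo_rel.intro simp: card_order_on_def)
  obtain b where b: "b \<in> Field R" "a \<noteq> b" "(a, b) \<in> R"
    using infinite_Card_order_limit[OF R a] by blast
  have ne: "AboveS {a} \<noteq> {}" using b by (auto simp: AboveS_def)
  have sub: "{a} \<subseteq> Field R" using a by simp
  let ?c = "suc {a}"
  have c: "?c \<in> Field R" "?c \<noteq> a" "(a, ?c) \<in> R"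
    using suc_inField[OF sub ne] suc_greater[OF sub ne] by auto
  have "(x, a) \<in> R" if x: "(x, ?c) \<in> R" "x \<noteq> ?c" for x
  proof (rule ccontr)
    assume "(x, a) \<notin> R"
    moreover have xF: "x \<in> Field R" using x by (auto simp: Field_def)
    ultimately have "(a, x) \<in> R" "x \<noteq> a" using TOTALS a in_notinI by blast+
    then have "x \<in> AboveS {a}" using xF by (auto simp: AboveS_def)
    then have "(?c, x) \<in> R" by (rule suc_least_AboveS)
    with x show False using ANTISYM by (auto dest: antisymD)
  qed
  with c have "succ_of R a ?c" by (auto simp: succ_of_def underS_def under_def)
  with c show ?thesis by blast
qed

lemma G_stage_subset_G:
  fixes r :: "'i rel"
  assumes p: "ultrafilter p" and r: "Well_order r" and a: "a \<in> Field r"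
  shows "G_stage p r a \<subseteq> G p"
proof -
  have p': "p \<noteq> bot" using p by (simp add: ultrafilter_def)
  obtain R :: "nat filter rel" where R: "Card_order R" "infinite (Field R)" "regularCard R"
    and less: "natLeq <o R" using ex_regular_order by blast
  have R': "Well_order R" using R(1) by (simp add: card_order_on_def)
  interpret R: wo_rel R using R' by (rule wo_rel.intro)
  interpret r: wo_rel r using r by (rule wo_rel.intro)
  let ?U = "\<Union>i\<in>Field R. G_stage p R i"
  have chain: "relChain R (G_stage p R)"
    using G_stage_mono[OF R' p'] by (simp add: relChain_def)
  have closed: "ulim p v \<in> ?U" if v: "\<And>n. v n \<in> ?U" for v
  proof -
    have "|range v| \<le>o |UNIV :: nat set|" by (rule card_of_image)
    also have "|UNIV :: nat set| =o natLeq" by (rule card_of_nat)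
    also have "natLeq <o R" by (rule less)
    finally have "\<exists>i\<in>Field R. range v \<subseteq> G_stage p R i"
      using v by (intro regularCard_UNION[OF R(1,3) chain]) auto
    then obtain i where i: "i \<in> Field R" "\<And>n. v n \<in> G_stage p R i" by blast
    obtain c where c: "c \<in> Field R" "succ_of R i c" using ex_succ_of[OF R(1,2) i(1)] by blast
    have "ulim p v \<in> G_stage p R c" using i(2) by (auto simp: G_stage_succ[OF R' c(2)])
    with c(1) show ?thesis by blast
  qed
  have "Field R \<noteq> {}" using R(2) by auto
  define z where "z = R.minim (Field R)"
  have z: "z \<in> Field R" "underS R z = {}"
  proof -
    show zF: "z \<in> Field R" unfolding z_def by (rule R.minim_in) (use \<open>Field R \<noteq> {}\<close> in auto)
    show "underS R z = {}"
    proof (rule equals0I)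
      fix x assume x: "x \<in> underS R z"
      then have "(z, x) \<in> R" unfolding z_def
        by (intro R.minim_least) (auto simp: underS_def Field_def)
      with x show False using R.ANTISYM by (auto simp: underS_def dest: antisymD)
    qed
  qed
  have "G_stage p r a \<subseteq> ?U"
  proof (induction a rule: r.well_order_induct)
    case (1 a)
    then have IH: "G_stage p r b \<subseteq> ?U" if "b \<in> underS r a" for b
      using that by (auto simp: underS_def)
    consider "underS r a = {}" | b where "succ_of r b a"
      | "underS r a \<noteq> {}" "\<nexists>b. succ_of r b a" by blast
    then show ?case
    proof cases
      case 1
      then have "G_stage p r a = G_stage p R z"
        by (simp add: G_stage_least[OF r] G_stage_least[OF R' z(2)])
      then show ?thesis using z(1) by blast
    next
      case (2 b)
      then have "b \<in> underS r a" by (simp add: succ_of_def)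
      from IH[OF this] show ?thesis
        using closed by (auto simp: G_stage_succ[OF r 2] subset_iff simp del: UN_iff)
    next
      case 3
      then show ?thesis using IH by (simp add: G_stage_limit[OF r] UN_subset_iff)
    qed
  qed
  also have "?U \<subseteq> G p" using R' unfolding G_def by blast
  finally show ?thesis .
qed

end

end

theory Submission
  imports Defs
begin

text \<open>
  \<open>G p\<close> is the least set of filters that contains the principal ultrafilters and is closed under
  \<open>p\<close>-limits: the closure holds because the hierarchy, taken along a well-order of regular
  uncountable length, puts any countably many of its members into a common stage. The theorem is
  then an induction on \<open>u\<close>, as limits along a principal ultrafilter are evaluations and limits
  along a \<open>p\<close>-limit are \<open>p\<close>-limits of limits.
\<close>

lemma ulim_principal: "ulim (principal {n}) v = v n"
  by (simp add: filter_eq_iff eventually_ulim eventually_principal)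

lemma ulim_ulim: "ulim (ulim u w) v = ulim u (\<lambda>n. ulim (w n) v)"
  by (simp add: filter_eq_iff eventually_ulim)

text \<open>Minimality of the hierarchy, by transfinite induction along \<open>r\<close>: successor
  stages use \<open>closed\<close>, limit stages are unions of earlier ones.\<close>

lemma G_stage_subset_closed:
  assumes r: "Well_order r"
    and principal: "\<And>n. principal {n} \<in> S"
    and closed: "\<And>v. (\<And>n. v n \<in> S) \<Longrightarrow> ulim p v \<in> S"
  shows "G_stage p r a \<subseteq> S"
proof -
  interpret wo_rel r using r by (rule wo_rel.intro)
  show ?thesis
  proof (induction a rule: well_order_induct)
    case (1 a)
    then have IH: "G_stage p r b \<subseteq> S" if "b \<in> underS a" for b
      using that by (auto simp: underS_def)
    consider "underS a = {}" | b where "succ_of r b a"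
      | "underS a \<noteq> {}" "\<nexists>b. succ_of r b a" by blast
    then show ?case
    proof cases
      case 1
      then show ?thesis using principal by (auto simp: G_stage_least[OF r])
    next
      case (2 b)
      then have "G_stage p r b \<subseteq> S" by (intro IH) (simp add: succ_of_def)
      then show ?thesis using closed by (auto simp: G_stage_succ[OF r 2])
    next
      case 3
      then show ?thesis using IH by (simp add: G_stage_limit[OF r] UN_subset_iff)
    qed
  qed
qed

lemma G_induct [consumes 1, case_names principal ulim]:
  assumes "u \<in> G p"
    and "\<And>n. P (principal {n})"
    and "\<And>v. (\<And>n. P (v n)) \<Longrightarrow> P (ulim p v)"
  shows "P u"
proof -
  obtain r :: "nat filter rel" and a where "Well_order r" "u \<in> G_stage p r a"
    using assms(1) by (auto simp: G_def)
  then show ?thesis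
    using G_stage_subset_closed[of r "Collect P" p a] assms(2,3) by auto
qed

context
  includes cardinal_syntax
begin

text \<open>The \<open>v n\<close> may come from stages along different well-orders, so all are
  first moved into the stages of one regular order \<open>R\<close>.\<close>

lemma ulim_in_G:
  assumes p: "p \<noteq> bot" and v: "\<And>n. v n \<in> G p"
  shows "ulim p v \<in> G p"
proof -
  obtain R :: "nat filter rel" where R: "Card_order R" "infinite (Field R)" "regularCard R"
    and less: "natLeq <o R" using ex_regular_order by blast
  have R': "Well_order R" using R(1) by (simp add: card_order_on_def)
  interpret wo_rel R using R' by (rule wo_rel.intro)
  define U where "U = (\<Union>i\<in>Field R. G_stage p R i)"
  have closed: "ulim p w \<in> U" if w: "\<And>n. w n \<in> U" for w
  proof -
    have "relChain R (G_stage p R)"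
      using G_stage_mono[OF R' p] by (simp add: relChain_def)
    moreover have "|range w| <o R"
      by (rule ordLeq_ordLess_trans[OF ordLeq_ordIso_trans[OF card_of_image card_of_nat] less])
    \<comment> \<open>By regularity, a countable subset of the union of the increasing chain lies in
      a single stage; the limit then appears at its successor \<open>c\<close>.\<close>
    ultimately have "\<exists>i\<in>Field R. range w \<subseteq> G_stage p R i"
      using w by (intro regularCard_UNION[OF R(1,3)]) (auto simp: U_def)
    then obtain i where i: "i \<in> Field R" "\<And>n. w n \<in> G_stage p R i" by blast
    obtain c where c: "c \<in> Field R" "succ_of R i c" using ex_succ_of[OF R(1,2) i(1)] by blast
    have "ulim p w \<in> G_stage p R c" using i(2) by (auto simp: G_stage_succ[OF R' c(2)])
    with c(1) show ?thesis by (auto simp: U_def)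
  qed
  have principal: "principal {n} \<in> U" for n
  proof -
    have ne: "Field R \<noteq> {}" using R(2) by auto
    define z where "z = minim (Field R)"
    have "z \<in> Field R" unfolding z_def by (rule minim_in) (use ne in auto)
    moreover have "(z, x) \<in> R" if "x \<in> Field R" for x
      unfolding z_def by (rule minim_least) (use that in auto)
    then have "underS z = {}"
      using ANTISYM by (auto simp: underS_def Field_def dest: antisymD)
    ultimately show ?thesis by (auto simp: U_def intro!: bexI[of _ z] simp: G_stage_least[OF R'])
  qed
  \<comment> \<open>\<open>U\<close> contains the principal ultrafilters and is closed under
    \<open>p\<close>-limits, so induction gives all of \<open>G p\<close>.\<close>
  have "v n \<in> U" for n
    using v[of n] principal closed by (rule G_induct)
  then have "ulim p v \<in> U" by (rule closed)
  then show ?thesis using R' by (auto simp: U_def G_def)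
qed

end

theorem theorem3p11:
  fixes p u :: "nat filter" and v :: "nat \<Rightarrow> nat filter"
  assumes "ultrafilter p"
    and "u \<in> G p"
    and "\<And>n. v n \<in> G p"
  shows "ulim u v \<in> G p"
  using assms(2)
proof (induction u rule: G_induct)
  case (principal n)
  show ?case using assms(3) by (simp add: ulim_principal)
next
  case (ulim w)
  have "p \<noteq> bot" using assms(1) by (simp add: ultrafilter_def)
  \<comment> \<open>The inner limits \<open>ulim (w n) v\<close> lie in \<open>G p\<close> by the
    induction hypothesis.\<close>
  then show ?case using ulim by (simp add: ulim_ulim ulim_in_G)
qed

end
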